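(* Let $H_{\mathfrak{M}}$ be the Hilbert basis of the monoid $\mathcal{M}$ and let $I_S\subset\mathbb{C}[a,b]$ be the Sibirsky ideal, as defined in the context. Then $$G=\{[\nu]-[\hat\nu] : \nu\in H_{\mathfrak{M}},\ \nu\ne\hat\nu\}$$ is a Gröbner basis of $I_S$ (with respect to any monomial order on $\mathbb{C}[a,b]$).
   Context: Let $\mathbb{N}_0=\{0,1,2,\dots\}$ and let $S=\{(p_1,q_1),\dots,(p_\ell,q_\ell)\}\subset(\mathbb{N}_0\cup\{-1\})\times\mathbb{N}_0$ be a set of $\ell$ distinct pairs with $p_j+q_j\ge1$ for all $j$. (It indexes the parameters of the system $\dot x=x-\sum_{(p,q)\in S}a_{pq}x^{p+1}y^q$, $\dot y=-y+\sum_{(p,q)\in S}b_{qp}x^qy^{p+1}$.) $\mathbb{C}[a,b]$ is the polynomial ring in the $2\ell$ independent variables $a_{p_1q_1},\dots,a_{p_\ell q_\ell},b_{q_\ell p_\ell},\dots,b_{q_1p_1}$ (in this order). For $\nu\in\mathbb{N}_0^{2\ell}$: $[\nu]=a_{p_1q_1}^{\nu_1}\cdots a_{p_\ell q_\ell}^{\nu_\ell}b_{q_\ell p_\ell}^{\nu_{\ell+1}}\cdots b_{q_1p_1}^{\nu_{2\ell}}$, $\hat\nu=(\nu_{2\ell},\nu_{2\ell-1},\dots,\nu_1)$, and $L(\nu)=\sum_{j=1}^\ell\big[\binom{p_j}{q_j}\nu_j+\binom{q_j}{p_j}\nu_{2\ell-j+1}\big]$. $\mathcal{M}=\{\nu\in\mathbb{N}_0^{2\ell}:L(\nu)=\binom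 KK\text{ for some }K\in\mathbb{N}_0\}$; equivalently $\mathcal{M}$ is the set of $\nu\in\mathbb{N}_0^{2\ell}$ with $\mathfrak{M}\nu^\top=0$, where $\mathfrak{M}=[(p_1-q_1)\ \cdots\ (p_\ell-q_\ell)\ (q_\ell-p_\ell)\ \cdots\ (q_1-p_1)]$. The Hilbert basis $H_{\mathfrak{M}}$ of $\mathcal{M}$ is its unique minimal generating set as a monoid. Equivalently (by a known algorithm), $H_{\mathfrak{M}}$ is the set of $\nu$ such that $[\nu]-\mathbf{y}^\nu$, $\mathbf{y}^\nu=y_1^{\nu_1}\cdots y_{2\ell}^{\nu_{2\ell}}$, appears in the reduced Gröbner basis, for an elimination order with $\{t\}\succ\{a,b\}\succ\{y\}$, of the ideal $\langle a_{p_sq_s}-y_st^{p_s-q_s},\ b_{q_sp_s}-y_{2\ell-s+1}t^{q_s-p_s}: s=1,\dots,\ell\rangle$. The Sibirsky ideal is $I_S=\langle[\nu]-[\hat\nu]:\nu\in\mathcal{M}\rangle\subset\mathbb{C}[a,b]$. *)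

theory Defs
  imports Complex_Main "HOL-Library.Poly_Mapping" "HOL-Algebra.Ideal"
begin

text \<open>
  The variables are indexed by \<open>1, ..., 2 * l\<close>, in the order
  \<open>a\<^sub>1, ..., a\<^sub>l, b\<^sub>l, ..., b\<^sub>1\<close>, where \<open>a\<^sub>j\<close> and \<open>b\<^sub>j\<close> stand for the
  parameters with subscripts \<open>(p\<^sub>j, q\<^sub>j)\<close> and \<open>(q\<^sub>j, p\<^sub>j)\<close>. So \<open>a\<^sub>j\<close> is variable number \<open>j\<close> and
  \<open>b\<^sub>j\<close> is variable number \<open>2 * l + 1 - j\<close>.
\<close>

type_synonym expvec = "nat \<Rightarrow>\<^sub>0 nat"
type_synonym cpoly = "expvec \<Rightarrow>\<^sub>0 complex"

definition expvecs :: "nat \<Rightarrow> expvec set"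
  where "expvecs n = {\<nu>. Poly_Mapping.keys \<nu> \<subseteq> {1..n}}"

text \<open>The type \<^typ>\<open>cpoly\<close> has infinitely many variables; the polynomial ring in \<open>n\<close> variables is
  the subring with the following carrier.\<close>

definition cpoly_ring :: "nat \<Rightarrow> cpoly ring"
  where "cpoly_ring n =
    \<lparr>carrier = {f. Poly_Mapping.keys f \<subseteq> expvecs n}, mult = (*), one = 1, zero = 0, add = (+)\<rparr>"

definition bracket :: "expvec \<Rightarrow> cpoly"
  where "bracket \<nu> = Poly_Mapping.single \<nu> 1"

lemma cring_cpoly_ring: "cring (cpoly_ring n)"
proof -
  have add: "u + v \<in> expvecs n" if "u \<in> expvecs n" "v \<in> expvecs n" for u v
    using that Poly_Mapping.keys_add[of u v] by (auto simp: expvecs_def)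
  show ?thesis
  proof (intro cringI abelian_groupI comm_monoidI)
    fix x y assume "x \<in> carrier (cpoly_ring n)" "y \<in> carrier (cpoly_ring n)"
    then show "x \<otimes>\<^bsub>cpoly_ring n\<^esub> y \<in> carrier (cpoly_ring n)"
      using keys_mult[of x y] add by (fastforce simp: cpoly_ring_def)
  next
    fix x y assume "x \<in> carrier (cpoly_ring n)" "y \<in> carrier (cpoly_ring n)"
    then show "x \<oplus>\<^bsub>cpoly_ring n\<^esub> y \<in> carrier (cpoly_ring n)"
      using Poly_Mapping.keys_add[of x y] by (auto simp: cpoly_ring_def)
  next
    fix x assume "x \<in> carrier (cpoly_ring n)"
    then show "\<exists>y\<in>carrier (cpoly_ring n). y \<oplus>\<^bsub>cpoly_ring n\<^esub> x = \<zero>\<^bsub>cpoly_ring n\<^esub>"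
      by (intro bexI[of _ "- x"]) (auto simp: cpoly_ring_def)
  qed (auto simp: cpoly_ring_def expvecs_def algebra_simps)
qed

lemma bracket_eq_prod:
  assumes "\<nu> \<in> expvecs n"
  shows "bracket \<nu> = (\<Prod>i\<in>{1..n}. bracket (Poly_Mapping.single i 1) ^ Poly_Mapping.lookup \<nu> i)"
proof -
  have pow: "bracket u ^ k = bracket (of_nat k * u)" for u k
    by (induction k) (auto simp: bracket_def mult_single algebra_simps)
  have prd: "(\<Prod>i\<in>A. bracket (f i)) = bracket (\<Sum>i\<in>A. f i)" if "finite A" for f :: "nat \<Rightarrow> expvec" and A
    using that by (induction A rule: finite_induct) (auto simp: bracket_def mult_single)
  have "(\<Prod>i\<in>{1..n}. bracket (Poly_Mapping.single i 1) ^ Poly_Mapping.lookup \<nu> i)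
      = bracket (\<Sum>i\<in>{1..n}. Poly_Mapping.single i (Poly_Mapping.lookup \<nu> i))"
    by (simp add: pow prd) (simp flip: single_of_nat add: mult_single)
  also have "(\<Sum>i\<in>{1..n}. Poly_Mapping.single i (Poly_Mapping.lookup \<nu> i)) = \<nu>"
  proof (rule poly_mapping_eqI)
    fix k
    have "k \<notin> {1..n} \<Longrightarrow> Poly_Mapping.lookup \<nu> k = 0"
      using assms by (auto simp: expvecs_def in_keys_iff)
    then show "Poly_Mapping.lookup (\<Sum>i\<in>{1..n}. Poly_Mapping.single i (Poly_Mapping.lookup \<nu> i)) k
        = Poly_Mapping.lookup \<nu> k"
      by (auto simp: lookup_sum lookup_single when_def)
  qed
  finally show ?thesis ..
qed


definition monomial_order :: "nat \<Rightarrow> expvec rel \<Rightarrow> bool"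
  where "monomial_order n r \<longleftrightarrow> well_order_on (expvecs n) r \<and>
    (\<forall>u v w. (u, v) \<in> r \<longrightarrow> w \<in> expvecs n \<longrightarrow> (u + w, v + w) \<in> r)"

definition lead_exp :: "expvec rel \<Rightarrow> cpoly \<Rightarrow> expvec"
  where "lead_exp r f =
    (THE u. u \<in> Poly_Mapping.keys f \<and> (\<forall>v\<in>Poly_Mapping.keys f. (v, u) \<in> r))"

definition lead_term :: "expvec rel \<Rightarrow> cpoly \<Rightarrow> cpoly"
  where "lead_term r f =
    Poly_Mapping.single (lead_exp r f) (Poly_Mapping.lookup f (lead_exp r f))"

definition groebner_basis :: "nat \<Rightarrow> expvec rel \<Rightarrow> cpoly set \<Rightarrow> cpoly set \<Rightarrow> bool"
  where "groebner_basis n r G I \<longleftrightarrow> finite G \<and> G \<subseteq> I - {0} \<and>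
    Idl\<^bsub>cpoly_ring n\<^esub> (lead_term r ` G) = Idl\<^bsub>cpoly_ring n\<^esub> (lead_term r ` (I - {0}))"


text \<open>The reversal \<open>(\<nu>\<^sub>1, ..., \<nu>\<^sub>n) \<mapsto> (\<nu>\<^sub>n, ..., \<nu>\<^sub>1)\<close>, used below with \<open>n = 2 * l\<close>.\<close>

lift_definition rev_vec :: "nat \<Rightarrow> expvec \<Rightarrow> expvec"
  is "\<lambda>n \<nu> i. if i \<in> {1..n} then \<nu> (n + 1 - i) else 0"
  by (rule finite_subset[where B = "{1..n}" for n]) auto

definition L :: "nat \<Rightarrow> (nat \<Rightarrow> int) \<Rightarrow> (nat \<Rightarrow> nat) \<Rightarrow> expvec \<Rightarrow> int \<times> int"
  where "L l p q \<nu> =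
    (\<Sum>j\<in>{1..l}. p j * int (Poly_Mapping.lookup \<nu> j)
       + int (q j) * int (Poly_Mapping.lookup \<nu> (2 * l - j + 1)),
     \<Sum>j\<in>{1..l}. int (q j) * int (Poly_Mapping.lookup \<nu> j)
       + p j * int (Poly_Mapping.lookup \<nu> (2 * l - j + 1)))"

definition sib_monoid :: "nat \<Rightarrow> (nat \<Rightarrow> int) \<Rightarrow> (nat \<Rightarrow> nat) \<Rightarrow> expvec set"
  where "sib_monoid l p q = {\<nu> \<in> expvecs (2 * l). \<exists>K::nat. L l p q \<nu> = (int K, int K)}"

definition sibirsky_ideal :: "nat \<Rightarrow> (nat \<Rightarrow> int) \<Rightarrow> (nat \<Rightarrow> nat) \<Rightarrow> cpoly set"
  where "sibirsky_ideal l p q =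
    Idl\<^bsub>cpoly_ring (2 * l)\<^esub> {bracket \<nu> - bracket (rev_vec (2 * l) \<nu>) | \<nu>. \<nu> \<in> sib_monoid l p q}"

definition add_submonoid :: "expvec set \<Rightarrow> bool"
  where "add_submonoid N \<longleftrightarrow> 0 \<in> N \<and> (\<forall>u\<in>N. \<forall>v\<in>N. u + v \<in> N)"

definition minimal_generating_set :: "expvec set \<Rightarrow> expvec set \<Rightarrow> bool"
  where "minimal_generating_set M H \<longleftrightarrow>
    add_submonoid hull H = M \<and> (\<forall>H'. H' \<subset> H \<longrightarrow> add_submonoid hull H' \<noteq> M)"

definition hilbert_basis :: "expvec set \<Rightarrow> expvec set"
  where "hilbert_basis M = (THE H. minimal_generating_set M H)"


text \<open>The definite description above is well-defined.\<close>

lemma ex1_minimal_generating_set: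
  assumes M: "add_submonoid M"
  shows "\<exists>!H. minimal_generating_set M H"
proof -
  define A where "A = {x \<in> M. x \<noteq> 0 \<and> (\<forall>u\<in>M. \<forall>v\<in>M. x = u + v \<longrightarrow> u = 0 \<or> v = 0)}"
  define deg :: "expvec \<Rightarrow> nat"
    where "deg x = (\<Sum>i\<in>Poly_Mapping.keys x. Poly_Mapping.lookup x i)" for x
  have deg_eq: "deg x = (\<Sum>i\<in>B. Poly_Mapping.lookup x i)"
    if "finite B" "Poly_Mapping.keys x \<subseteq> B" for x B
    unfolding deg_def using that by (intro sum.mono_neutral_left) (auto simp: in_keys_iff)
  have deg_add: "deg (u + v) = deg u + deg v" for u v
    using Poly_Mapping.keys_add[of u v]
    by (simp add: deg_eq[of "Poly_Mapping.keys u \<union> Poly_Mapping.keys v"] lookup_add sum.distrib)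
  have deg_pos: "deg x > 0" if x: "x \<noteq> 0" for x
  proof -
    have "\<exists>i. Poly_Mapping.lookup x i \<noteq> 0"
      using x by (metis lookup_zero poly_mapping_eqI)
    then obtain i where i: "Poly_Mapping.lookup x i \<noteq> 0" by blast
    then show ?thesis
      unfolding deg_def by (intro sum_pos2[of _ i]) (auto simp: in_keys_iff)
  qed
  have hull_sub: "add_submonoid (add_submonoid hull B)" for B
    by (rule hull_in) (auto simp: add_submonoid_def)
  have AM: "A \<subseteq> M" by (auto simp: A_def)
  have "x \<in> add_submonoid hull A" if "x \<in> M" for x
    using that
  proof (induction "deg x" arbitrary: x rule: less_induct)
    case less
    consider "x = 0" | "x \<in> A" | u v where "u \<in> M" "v \<in> M" "x = u + v" "u \<noteq> 0" "v \<noteq> 0"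
      using less.prems by (auto simp: A_def)
    then show ?case
    proof cases
      case 1
      then show ?thesis using hull_sub[of A] by (simp add: add_submonoid_def)
    next
      case 2
      then show ?thesis by (rule hull_inc)
    next
      case 3
      then have "u \<in> add_submonoid hull A" "v \<in> add_submonoid hull A"
        using less.hyps deg_add deg_pos by auto
      then show ?thesis using 3 hull_sub[of A] by (simp add: add_submonoid_def)
    qed
  qed
  then have hull_A: "add_submonoid hull A = M"
    using hull_minimal[of A M add_submonoid] AM M by auto
  have A_le: "A \<subseteq> B" if B: "add_submonoid hull B = M" for B
  proof
    fix x assume x: "x \<in> A"
    define N where "N = {y \<in> M. y \<in> A \<longrightarrow> y \<in> B}"
    have "B \<subseteq> N" using B hull_subset[of B add_submonoid] by (auto simp: N_def)
    moreover have "add_submonoid N"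
      unfolding add_submonoid_def
    proof (intro conjI ballI)
      show "0 \<in> N" using M by (simp add: N_def A_def add_submonoid_def)
    next
      fix u v assume uv: "u \<in> N" "v \<in> N"
      then have "u \<in> M" "v \<in> M" by (auto simp: N_def)
      then have "u + v \<in> A \<Longrightarrow> u = 0 \<or> v = 0" by (simp add: A_def)
      moreover have "u + v \<in> M" using uv M by (simp add: N_def add_submonoid_def)
      ultimately show "u + v \<in> N" using uv by (auto simp: N_def)
    qed
    ultimately have "add_submonoid hull B \<subseteq> N" by (rule hull_minimal)
    then show "x \<in> B" using x AM B by (auto simp: N_def)
  qed
  show ?thesis
  proof (rule ex1I[of _ A])
    show "minimal_generating_set M A"
      unfolding minimal_generating_set_def using hull_A A_le by blast
  next
    fix H assume "minimal_generating_set M H"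
    then show "H = A"
      unfolding minimal_generating_set_def using hull_A A_le[of H] by blast
  qed
qed

lemma add_submonoid_sib_monoid: "add_submonoid (sib_monoid l p q)"
  unfolding add_submonoid_def
proof (intro conjI ballI)
  show "0 \<in> sib_monoid l p q"
    by (auto simp: sib_monoid_def expvecs_def L_def intro: exI[of _ 0])
next
  fix u v assume "u \<in> sib_monoid l p q" "v \<in> sib_monoid l p q"
  then obtain a b where uv: "u \<in> expvecs (2 * l)" "v \<in> expvecs (2 * l)"
      and L: "L l p q u = (int a, int a)" "L l p q v = (int b, int b)"
    by (auto simp: sib_monoid_def)
  have "L l p q (u + v)
      = (fst (L l p q u) + fst (L l p q v), snd (L l p q u) + snd (L l p q v))"
    by (simp add: L_def lookup_add algebra_simps sum.distrib)
  then have "L l p q (u + v) = (int (a + b), int (a + b))"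
    by (simp add: L)
  moreover have "u + v \<in> expvecs (2 * l)"
    using uv Poly_Mapping.keys_add[of u v] by (auto simp: expvecs_def)
  ultimately show "u + v \<in> sib_monoid l p q"
    unfolding sib_monoid_def by blast
qed

end

theory Submission
  imports Defs "HOL-Library.Product_Plus"
begin

text \<open>
  Write \<open>rev u\<close> for the reversal of an exponent vector \<open>u\<close>, \<open>wt u\<close> for its value under the linear
  form with coefficients \<open>p\<^sub>j - q\<^sub>j\<close> and, mirrored, \<open>q\<^sub>j - p\<^sub>j\<close>, and \<open>M\<close> for the monoid, which is the
  set of \<open>u\<close> with \<open>wt u = 0\<close> (lemma \<open>sib_monoid_iff_weight\<close>). Two observations carry the proof.

  The first is that the ideal sees only two additive invariants of \<open>u\<close>, namely \<open>u + rev u\<close> and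
  \<open>wt u\<close>. Since \<open>wt (rev \<nu>) = - wt \<nu>\<close>, both agree on \<open>\<nu>\<close> and \<open>rev \<nu>\<close> when \<open>\<nu>\<close> lies in \<open>M\<close>. Hence
  collecting the coefficients of a polynomial along the level sets of the invariants is a ring
  homomorphism that kills the Sibirsky ideal. So if \<open>u\<close> is the leading exponent of a nonzero element
  of the ideal, a second exponent \<open>v < u\<close> with the same invariants must occur in that element, for
  otherwise the leading coefficient would survive. Equality of the invariants forces the truncated
  difference \<open>\<nu> = u - v\<close> to lie in \<open>M\<close> and the opposite difference \<open>v - u\<close> to be \<open>rev \<nu>\<close>. With \<open>w\<close> the
  componentwise minimum of \<open>u\<close> and \<open>v\<close> this reads \<open>u = w + \<nu>\<close> and \<open>v = w + rev \<nu>\<close>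
  (lemma \<open>sibirsky_lead_exp_partner\<close>).

  The second passes from \<open>\<nu>\<close> to the Hilbert basis. Write \<open>\<nu>\<close> as a sum of basis elements \<open>h\<close>. If
  \<open>h \<le> rev h\<close> held for every summand, adding up would give \<open>\<nu> \<le> rev \<nu>\<close> and so \<open>u \<le> v\<close>. Hence some
  summand has \<open>rev h < h\<close>, and the leading monomial \<open>[h]\<close> of \<open>[h] - [rev h]\<close> divides \<open>[\<nu>]\<close>, and with
  it \<open>[u]\<close> (lemma \<open>hull_descending_generator\<close>).

  Finiteness of the Hilbert basis comes from Dickson's lemma: basis elements are indecomposable, and
  as \<open>M\<close> is closed under those differences that are nonnegative, they form an antichain.
\<close>

section \<open>Dickson's lemma\<close>

lemma incseq_subseq_wellorder:
  fixes s :: "nat \<Rightarrow> 'a::wellorder"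
  shows "\<exists>g. strict_mono g \<and> incseq (\<lambda>n. s (g n))"
proof -
  obtain f where f: "strict_mono f" "monoseq (\<lambda>n. s (f n))"
    using seq_monosub[of s] by blast
  show ?thesis
  proof (cases "incseq (\<lambda>n. s (f n))")
    case True
    with f show ?thesis by blast
  next
    case False
    with f have dec: "decseq (\<lambda>n. s (f n))" by (simp add: monoseq_iff)
    \<comment> \<open>A decreasing sequence in a well-order is constant once it has reached its least value.\<close>
    define m where "m = (LEAST x. x \<in> range (\<lambda>n. s (f n)))"
    have "m \<in> range (\<lambda>n. s (f n))" unfolding m_def by (rule LeastI) auto
    then obtain N where N: "m = s (f N)" by blast
    have "s (f (n + N)) = m" for n
    proof (rule antisym)
      show "s (f (n + N)) \<le> m" using dec N by (auto simp: decseq_def)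
      show "m \<le> s (f (n + N))" unfolding m_def by (rule Least_le) auto
    qed
    moreover have "strict_mono (\<lambda>n. f (n + N))"
      using f(1) by (auto simp: strict_mono_def)
    ultimately show ?thesis by (intro exI[of _ "\<lambda>n. f (n + N)"]) (auto simp: incseq_def)
  qed
qed

lemma dickson_subseq:
  fixes f :: "nat \<Rightarrow> 'i \<Rightarrow> 'a::wellorder"
  assumes "finite A"
  shows "\<exists>g. strict_mono g \<and> (\<forall>i\<in>A. incseq (\<lambda>n. f (g n) i))"
  using assms
proof (induction A rule: finite_induct)
  case empty
  show ?case by (intro exI[of _ id]) (auto simp: strict_mono_def)
next
  case (insert a A)
  then obtain g where g: "strict_mono g" "\<forall>i\<in>A. incseq (\<lambda>n. f (g n) i)" by blast
  obtain h where h: "strict_mono h" "incseq (\<lambda>n. f (g (h n)) a)"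
    using incseq_subseq_wellorder[of "\<lambda>n. f (g n) a"] by blast
  have hmono: "h m \<le> h n" if "m \<le> n" for m n
    using h(1) that by (simp add: strict_mono_less_eq)
  show ?case
    using g h by (intro exI[of _ "\<lambda>n. g (h n)"]) (auto simp: strict_mono_def incseq_def hmono)
qed

lemma finite_antichain:
  fixes B :: "('i \<Rightarrow>\<^sub>0 'a::{wellorder,zero}) set"
  assumes "finite A" and keys: "\<And>x. x \<in> B \<Longrightarrow> Poly_Mapping.keys x \<subseteq> A"
    and anti: "\<And>x y. \<lbrakk>x \<in> B; y \<in> B; \<forall>i. Poly_Mapping.lookup x i \<le> Poly_Mapping.lookup y i\<rbrakk> \<Longrightarrow> x = y"
  shows "finite B"
proof (rule ccontr)
  assume "infinite B"
  then obtain f :: "nat \<Rightarrow> 'i \<Rightarrow>\<^sub>0 'a" where f: "inj f" "range f \<subseteq> B"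
    using infinite_countable_subset by blast
  obtain g :: "nat \<Rightarrow> nat" where g: "strict_mono g"
      "\<forall>i\<in>A. incseq (\<lambda>n. Poly_Mapping.lookup (f (g n)) i)"
    using dickson_subseq[OF \<open>finite A\<close>, of "\<lambda>n. Poly_Mapping.lookup (f n)"] by blast
  have "Poly_Mapping.lookup (f (g 0)) i \<le> Poly_Mapping.lookup (f (g 1)) i" for i
  proof (cases "i \<in> A")
    case True
    then show ?thesis using g(2) by (auto simp: incseq_def)
  next
    case False
    then have "i \<notin> Poly_Mapping.keys (f n)" for n using keys f(2) by blast
    then show ?thesis by (simp add: in_keys_iff)
  qed
  then have "f (g 0) = f (g 1)" using anti f(2) by blast
  then have "g 0 = g 1" using f(1) by (simp add: inj_eq)
  then show False using g(1) by (simp add: strict_mono_eq)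
qed


section \<open>Hilbert bases\<close>

lemma add_submonoid_hull: "add_submonoid (add_submonoid hull B)"
  by (rule hull_in) (auto simp: add_submonoid_def)

lemma hilbert_basis_minimal:
  assumes "add_submonoid M"
  shows "minimal_generating_set M (hilbert_basis M)"
  unfolding hilbert_basis_def by (rule theI'[OF ex1_minimal_generating_set[OF assms]])

text \<open>If \<open>h = u + v\<close> were a proper decomposition, then \<open>u\<close> and \<open>v\<close>, being too small to involve \<open>h\<close>,
  would be generated by the other basis elements, and \<open>h\<close> could be dropped.\<close>

lemma hilbert_basis_indecomposable:
  assumes M: "add_submonoid M" and h: "h \<in> hilbert_basis M"
    and uv: "u \<in> M" "v \<in> M" "h = u + v"
  shows "u = 0 \<or> v = 0"
proof (rule ccontr)
  assume nz: "\<not> (u = 0 \<or> v = 0)"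
  define H where "H = hilbert_basis M"
  define R where "R = add_submonoid hull (H - {h})"
  have min: "add_submonoid hull H = M" "\<And>H'. H' \<subset> H \<Longrightarrow> add_submonoid hull H' \<noteq> M"
    using hilbert_basis_minimal[OF M] by (auto simp: minimal_generating_set_def H_def)
  have R: "add_submonoid R" unfolding R_def by (rule add_submonoid_hull)
  \<comment> \<open>Every element of the monoid lies componentwise above \<open>h\<close> or is generated without \<open>h\<close>.\<close>
  define N where "N = R \<union> range (\<lambda>d. h + d)"
  have "add_submonoid N"
    unfolding add_submonoid_def
  proof (intro conjI ballI)
    show "0 \<in> N" using R by (simp add: N_def add_submonoid_def)
  next
    fix x y assume "x \<in> N" "y \<in> N"
    then consider "x \<in> R" "y \<in> R" | d where "x = h + d" | d where "y = h + d"
      by (auto simp: N_def)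
    then show "x + y \<in> N"
    proof cases
      case 1
      then show ?thesis using R by (simp add: N_def add_submonoid_def)
    next
      case (2 d)
      then have "x + y = h + (d + y)" by (simp add: add.assoc)
      then show ?thesis by (auto simp: N_def)
    next
      case (3 d)
      then have "x + y = h + (x + d)" by (simp add: add.left_commute)
      then show ?thesis by (auto simp: N_def)
    qed
  qed
  moreover have "H \<subseteq> N"
    using hull_subset[of "H - {h}" add_submonoid] by (auto simp: N_def R_def intro: range_eqI[of _ _ 0])
  ultimately have MN: "M \<subseteq> N" using hull_minimal min(1) by metis
  have *: "h + d + e = h \<Longrightarrow> e = 0" for d e :: expvec
  proof -
    assume "h + d + e = h"
    then have "d + e = 0" by (simp add: add.assoc)
    then have "Poly_Mapping.lookup d i + Poly_Mapping.lookup e i = 0" for i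
      by (metis lookup_add lookup_zero)
    then show "e = 0" by (intro poly_mapping_eqI) auto
  qed
  have "u \<noteq> h + d" for d using *[of d v] uv(3) nz by metis
  then have "u \<in> R" using MN uv(1) by (auto simp: N_def)
  moreover have "v \<noteq> h + d" for d using *[of d u] uv(3) nz by (metis add.commute)
  then have "v \<in> R" using MN uv(2) by (auto simp: N_def)
  ultimately have "h \<in> R" using R uv by (auto simp: add_submonoid_def)
  then have "H \<subseteq> R" using hull_subset[of "H - {h}" add_submonoid] by (auto simp: R_def)
  then have "M \<subseteq> R" using hull_minimal R min(1) by metis
  moreover have "R \<subseteq> M" unfolding R_def min(1)[symmetric] by (rule hull_mono) auto
  ultimately show False using min(2)[of "H - {h}"] h by (auto simp: R_def H_def)
qed

lemma hilbert_basis_nonzero: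
  assumes M: "add_submonoid M" and "h \<in> hilbert_basis M"
  shows "h \<noteq> 0"
proof
  assume "h = 0"
  define H where "H = hilbert_basis M"
  have "H \<subseteq> add_submonoid hull (H - {0})"
    using hull_subset[of "H - {0}" add_submonoid] add_submonoid_hull[of "H - {0}"]
    by (auto simp: add_submonoid_def)
  then have "add_submonoid hull H \<subseteq> add_submonoid hull (H - {0})"
    by (rule hull_minimal) (rule add_submonoid_hull)
  moreover have "add_submonoid hull (H - {0}) \<subseteq> add_submonoid hull H" by (rule hull_mono) auto
  moreover have "H - {0} \<subset> H" using assms(2) \<open>h = 0\<close> by (auto simp: H_def)
  ultimately show False
    using hilbert_basis_minimal[OF M] unfolding minimal_generating_set_def H_def by blast
qed

text \<open>Closure under differences turns indecomposability into incomparability, and Dickson's lemma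
  applies.\<close>

lemma finite_hilbert_basis:
  assumes M: "add_submonoid M" "M \<subseteq> expvecs n"
    and diff: "\<And>u d. \<lbrakk>u \<in> M; u + d \<in> M\<rbrakk> \<Longrightarrow> d \<in> M"
  shows "finite (hilbert_basis M)"
proof (rule finite_antichain[of "{1..n}"])
  have HM: "hilbert_basis M \<subseteq> M"
    using hilbert_basis_minimal[OF M(1)] hull_subset[of "hilbert_basis M" add_submonoid]
    by (simp add: minimal_generating_set_def)
  fix x assume x: "x \<in> hilbert_basis M"
  then show "Poly_Mapping.keys x \<subseteq> {1..n}" using HM M(2) by (auto simp: expvecs_def)
  fix y assume y: "y \<in> hilbert_basis M"
    and le: "\<forall>i. Poly_Mapping.lookup x i \<le> Poly_Mapping.lookup y i"
  have eq: "y = x + (y - x)"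
    using le by (intro poly_mapping_eqI) (simp add: lookup_add lookup_minus)
  then have "y - x \<in> M" using diff x y HM by (metis subsetD)
  then have "x = 0 \<or> y - x = 0"
    using hilbert_basis_indecomposable[OF M(1) y] x HM eq by blast
  then show "x = y" using hilbert_basis_nonzero[OF M(1) x] eq by simp
qed simp


section \<open>Monomial orders\<close>

lemma add_expvecs: "u \<in> expvecs n \<Longrightarrow> v \<in> expvecs n \<Longrightarrow> u + v \<in> expvecs n"
  using Poly_Mapping.keys_add[of u v] by (auto simp: expvecs_def)

lemma diff_expvecs: "u \<in> expvecs n \<Longrightarrow> u - v \<in> expvecs n"
  by (auto simp: expvecs_def lookup_minus in_keys_iff subset_iff)

lemma monomial_orderD:
  assumes "monomial_order n r"
  shows monomial_order_refl: "u \<in> expvecs n \<Longrightarrow> (u, u) \<in> r"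
    and monomial_order_trans: "(u, v) \<in> r \<Longrightarrow> (v, w) \<in> r \<Longrightarrow> (u, w) \<in> r"
    and monomial_order_antisym: "(u, v) \<in> r \<Longrightarrow> (v, u) \<in> r \<Longrightarrow> u = v"
    and monomial_order_total: "u \<in> expvecs n \<Longrightarrow> v \<in> expvecs n \<Longrightarrow> (u, v) \<in> r \<or> (v, u) \<in> r"
    and monomial_order_add: "(u, v) \<in> r \<Longrightarrow> w \<in> expvecs n \<Longrightarrow> (u + w, v + w) \<in> r"
proof -
  have lin: "refl_on (expvecs n) r" "trans r" "antisym r" "total_on (expvecs n) r"
    and add: "\<forall>u v w. (u, v) \<in> r \<longrightarrow> w \<in> expvecs n \<longrightarrow> (u + w, v + w) \<in> r"
    using assms
    by (auto simp: monomial_order_def well_order_on_def linear_order_on_def partial_order_on_def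
        preorder_on_def)
  show refl: "(u, u) \<in> r" if "u \<in> expvecs n" for u
    using lin(1) that by (rule refl_onD)
  show "(u, w) \<in> r" if "(u, v) \<in> r" "(v, w) \<in> r" using lin(2) that by (rule transD)
  show "u = v" if "(u, v) \<in> r" "(v, u) \<in> r" using lin(3) that by (rule antisymD)
  show "(u, v) \<in> r \<or> (v, u) \<in> r" if "u \<in> expvecs n" "v \<in> expvecs n"
    using refl lin(4) that unfolding total_on_def by (cases "u = v") blast+
  show "(u + w, v + w) \<in> r" if "(u, v) \<in> r" "w \<in> expvecs n"
    using add that by simp
qed

lemma lead_exp_eqI:
  assumes "monomial_order n r" "u \<in> Poly_Mapping.keys f" "\<And>v. v \<in> Poly_Mapping.keys f \<Longrightarrow> (v, u) \<in> r"
  shows "lead_exp r f = u"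
  unfolding lead_exp_def using assms monomial_order_antisym[OF assms(1)] by (intro the_equality) auto

lemma lead_exp_greatest:
  assumes r: "monomial_order n r" and f: "Poly_Mapping.keys f \<subseteq> expvecs n" "f \<noteq> 0"
  shows "lead_exp r f \<in> Poly_Mapping.keys f"
    and "v \<in> Poly_Mapping.keys f \<Longrightarrow> (v, lead_exp r f) \<in> r"
proof -
  have "\<exists>u\<in>K. \<forall>v\<in>K. (v, u) \<in> r" if "finite K" "K \<noteq> {}" "K \<subseteq> expvecs n" for K
    using that
  proof (induction K rule: finite_ne_induct)
    case (singleton x)
    then show ?case using monomial_order_refl[OF r] by auto
  next
    case (insert x K)
    then obtain u where u: "u \<in> K" "\<forall>v\<in>K. (v, u) \<in> r" by auto
    have xu: "x \<in> expvecs n" "u \<in> expvecs n" using insert.prems u(1) by auto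
    have refl: "(x, x) \<in> r" by (rule monomial_order_refl[OF r xu(1)])
    have "(x, u) \<in> r \<or> (u, x) \<in> r" using monomial_order_total[OF r xu] .
    then show ?case
    proof
      assume "(x, u) \<in> r"
      then show ?thesis using u by auto
    next
      assume "(u, x) \<in> r"
      then have "\<forall>v\<in>insert x K. (v, x) \<in> r" using u refl monomial_order_trans[OF r] by blast
      then show ?thesis by blast
    qed
  qed
  from this[of "Poly_Mapping.keys f"] f obtain u
    where u: "u \<in> Poly_Mapping.keys f" "\<forall>v\<in>Poly_Mapping.keys f. (v, u) \<in> r"
    by auto
  then have "lead_exp r f = u" using lead_exp_eqI[OF r] by blast
  with u show "lead_exp r f \<in> Poly_Mapping.keys f"
    and "v \<in> Poly_Mapping.keys f \<Longrightarrow> (v, lead_exp r f) \<in> r" by auto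
qed

lemma keys_bracket_diff:
  "u \<noteq> v \<Longrightarrow> Poly_Mapping.keys (bracket u - bracket v) = {u, v}"
  by (auto simp: bracket_def in_keys_iff lookup_minus lookup_single when_def split: if_splits)

lemma lead_term_bracket_diff:
  assumes "monomial_order n r" "u \<in> expvecs n" "(v, u) \<in> r" "u \<noteq> v"
  shows "lead_term r (bracket u - bracket v) = bracket u"
proof -
  have "lead_exp r (bracket u - bracket v) = u"
    using assms monomial_order_refl[OF assms(1)]
    by (intro lead_exp_eqI[OF assms(1)]) (auto simp: keys_bracket_diff)
  then show ?thesis
    using assms(4) by (simp add: lead_term_def bracket_def lookup_minus lookup_single)
qed

text \<open>In the monomial order, the elements \<open>x\<close> with \<open>x \<le> \<sigma> x\<close>, together with all sums \<open>h + d\<close> for a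
  generator \<open>h\<close> with \<open>\<sigma> h < h\<close>, form a submonoid that contains all generators.\<close>

lemma hull_descending_generator:
  assumes r: "monomial_order n r" and H: "H \<subseteq> expvecs n"
    and \<sigma>0: "\<sigma> 0 = 0" and \<sigma>_add: "\<And>u v. \<sigma> (u + v) = \<sigma> u + \<sigma> v"
    and \<sigma>_expvecs: "\<And>u. u \<in> expvecs n \<Longrightarrow> \<sigma> u \<in> expvecs n"
    and x: "x \<in> add_submonoid hull H" "(x, \<sigma> x) \<notin> r"
  shows "\<exists>h\<in>H. \<exists>d\<in>expvecs n. x = h + d \<and> (\<sigma> h, h) \<in> r \<and> h \<noteq> \<sigma> h"
proof -
  define P where "P = {x. \<exists>h\<in>H. \<exists>d\<in>expvecs n. x = h + d \<and> (\<sigma> h, h) \<in> r \<and> h \<noteq> \<sigma> h}"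
  define N where "N = {x \<in> expvecs n. (x, \<sigma> x) \<in> r \<or> x \<in> P}"
  have zero: "0 \<in> expvecs n" by (simp add: expvecs_def)
  have P_add: "u + v \<in> P" if uv: "u \<in> P" "v \<in> expvecs n" for u v
  proof -
    obtain h d where hd: "h \<in> H" "d \<in> expvecs n" "u = h + d" "(\<sigma> h, h) \<in> r" "h \<noteq> \<sigma> h"
      using uv(1) by (auto simp: P_def)
    moreover have "u + v = h + (d + v)" "d + v \<in> expvecs n"
      using hd uv(2) by (auto simp: add.assoc add_expvecs)
    ultimately show ?thesis unfolding P_def by blast
  qed
  have "add_submonoid N"
    unfolding add_submonoid_def
  proof (intro conjI ballI)
    show "0 \<in> N" using zero monomial_order_refl[OF r zero] \<sigma>0 by (simp add: N_def)
  next
    fix u v assume "u \<in> N" "v \<in> N"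
    then have uv: "u \<in> expvecs n" "v \<in> expvecs n"
      "(u, \<sigma> u) \<in> r \<or> u \<in> P" "(v, \<sigma> v) \<in> r \<or> v \<in> P" by (auto simp: N_def)
    have "u + v \<in> P" if "u \<in> P \<or> v \<in> P"
      using that P_add[of u v] P_add[of v u] uv by (auto simp: add.commute)
    moreover have "(u + v, \<sigma> (u + v)) \<in> r" if "(u, \<sigma> u) \<in> r" "(v, \<sigma> v) \<in> r"
    proof -
      have "(u + v, \<sigma> u + v) \<in> r" by (rule monomial_order_add[OF r that(1) uv(2)])
      moreover have "(v + \<sigma> u, \<sigma> v + \<sigma> u) \<in> r"
        by (rule monomial_order_add[OF r that(2) \<sigma>_expvecs[OF uv(1)]])
      ultimately show ?thesis
        using monomial_order_trans[OF r] by (simp add: \<sigma>_add add.commute)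
    qed
    ultimately show "u + v \<in> N" using uv add_expvecs by (auto simp: N_def)
  qed
  moreover have "H \<subseteq> N"
  proof
    fix h assume h: "h \<in> H"
    then have he: "h \<in> expvecs n" using H by auto
    have "h \<in> P" if "(\<sigma> h, h) \<in> r" "h \<noteq> \<sigma> h"
      unfolding P_def using h that zero by force
    then show "h \<in> N"
      using he monomial_order_total[OF r he \<sigma>_expvecs[OF he]] monomial_order_refl[OF r he]
      by (cases "h = \<sigma> h") (auto simp: N_def)
  qed
  ultimately have "x \<in> N" using hull_minimal x(1) by blast
  then show ?thesis using x(2) by (auto simp: N_def P_def)
qed


section \<open>Collecting coefficients along an additive map\<close>

text \<open>For additive \<open>\<phi>\<close>, this is the homomorphism of monoid algebras induced by \<open>\<phi>\<close>.\<close>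

definition push :: "('a \<Rightarrow> 'b) \<Rightarrow> ('a \<Rightarrow>\<^sub>0 'c) \<Rightarrow> 'b \<Rightarrow>\<^sub>0 'c::comm_monoid_add"
  where "push \<phi> f = (\<Sum>u\<in>Poly_Mapping.keys f. Poly_Mapping.single (\<phi> u) (Poly_Mapping.lookup f u))"

lemma push_superset:
  assumes "finite A" "Poly_Mapping.keys f \<subseteq> A"
  shows "push \<phi> f = (\<Sum>u\<in>A. Poly_Mapping.single (\<phi> u) (Poly_Mapping.lookup f u))"
  unfolding push_def using assms by (intro sum.mono_neutral_left) (auto simp: in_keys_iff)

lemma push_single: "push \<phi> (Poly_Mapping.single u c) = Poly_Mapping.single (\<phi> u) c"
  by (subst push_superset[of "{u}"]) auto

lemma push_zero [simp]: "push \<phi> 0 = 0"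
  by (simp add: push_def)

lemma push_add: "push \<phi> (f + g) = push \<phi> f + push \<phi> g"
proof -
  define A where "A = Poly_Mapping.keys f \<union> Poly_Mapping.keys g"
  have "push \<phi> h = (\<Sum>u\<in>A. Poly_Mapping.single (\<phi> u) (Poly_Mapping.lookup h u))"
    if "h \<in> {f, g, f + g}" for h
    using that Poly_Mapping.keys_add[of f g] by (intro push_superset) (auto simp: A_def)
  then show ?thesis by (simp add: lookup_add single_add sum.distrib)
qed

lemma push_diff:
  fixes f g :: "'a \<Rightarrow>\<^sub>0 'c::ab_group_add"
  shows "push \<phi> (f - g) = push \<phi> f - push \<phi> g"
  using push_add[of \<phi> "f - g" g] by (simp add: algebra_simps)

lemma push_sum: "push \<phi> (sum f A) = (\<Sum>a\<in>A. push \<phi> (f a))"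
  by (induction A rule: infinite_finite_induct) (auto simp: push_add)

lemma poly_mapping_eq_sum_single:
  "f = (\<Sum>u\<in>Poly_Mapping.keys f. Poly_Mapping.single u (Poly_Mapping.lookup f u))"
  by (rule poly_mapping_eqI) (auto simp: lookup_sum lookup_single when_def in_keys_iff)

lemma push_mult:
  fixes f g :: "'a::monoid_add \<Rightarrow>\<^sub>0 'c::semiring_0" and \<phi> :: "'a \<Rightarrow> 'b::monoid_add"
  assumes \<phi>: "\<And>u v. \<phi> (u + v) = \<phi> u + \<phi> v"
  shows "push \<phi> (f * g) = push \<phi> f * push \<phi> g"
proof -
  have "f * g = (\<Sum>u\<in>Poly_Mapping.keys f. \<Sum>v\<in>Poly_Mapping.keys g.
      Poly_Mapping.single (u + v) (Poly_Mapping.lookup f u * Poly_Mapping.lookup g v))"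
    by (subst poly_mapping_eq_sum_single[of f], subst poly_mapping_eq_sum_single[of g])
      (simp add: sum_product mult_single)
  then show ?thesis
    by (simp add: push_sum push_single \<phi> sum_product mult_single push_def[of \<phi> f] push_def[of \<phi> g])
qed

lemma ideal_push_kernel:
  assumes \<phi>: "\<And>u v. \<phi> (u + v) = \<phi> u + (\<phi> v :: 'b::comm_monoid_add)"
  shows "ideal {f \<in> carrier (cpoly_ring n). push \<phi> f = 0} (cpoly_ring n)"
proof -
  interpret R: cring "cpoly_ring n" by (rule cring_cpoly_ring)
  have uminus: "\<ominus>\<^bsub>cpoly_ring n\<^esub> f = - f" if "f \<in> carrier (cpoly_ring n)" for f
    using that by (intro R.minus_equality) (auto simp: cpoly_ring_def)
  have push_uminus: "push \<phi> (- f) = - push \<phi> f" for f :: cpoly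
    using push_diff[of \<phi> 0 f] by simp
  show ?thesis
  proof (rule idealI[OF R.ring_axioms])
    show "subgroup {f \<in> carrier (cpoly_ring n). push \<phi> f = 0} (add_monoid (cpoly_ring n))"
    proof (rule R.add.subgroupI)
      fix f assume f: "f \<in> {f \<in> carrier (cpoly_ring n). push \<phi> f = 0}"
      then have "\<ominus>\<^bsub>cpoly_ring n\<^esub> f \<in> carrier (cpoly_ring n)" by simp
      then show "\<ominus>\<^bsub>cpoly_ring n\<^esub> f \<in> {f \<in> carrier (cpoly_ring n). push \<phi> f = 0}"
        using f by (simp add: uminus push_uminus)
    next
      fix f g assume f: "f \<in> {f \<in> carrier (cpoly_ring n). push \<phi> f = 0}"
        and g: "g \<in> {f \<in> carrier (cpoly_ring n). push \<phi> f = 0}"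
      then have "f \<oplus>\<^bsub>cpoly_ring n\<^esub> g \<in> carrier (cpoly_ring n)" by simp
      then show "f \<oplus>\<^bsub>cpoly_ring n\<^esub> g \<in> {f \<in> carrier (cpoly_ring n). push \<phi> f = 0}"
        using f g by (auto simp: push_add cpoly_ring_def)
    qed (auto intro!: exI[of _ 0] simp: cpoly_ring_def)
  next
    fix f g assume f: "f \<in> {f \<in> carrier (cpoly_ring n). push \<phi> f = 0}"
      and g: "g \<in> carrier (cpoly_ring n)"
    have "g \<otimes>\<^bsub>cpoly_ring n\<^esub> f \<in> carrier (cpoly_ring n)"
      "f \<otimes>\<^bsub>cpoly_ring n\<^esub> g \<in> carrier (cpoly_ring n)" using f g by auto
    then show "g \<otimes>\<^bsub>cpoly_ring n\<^esub> f \<in> {f \<in> carrier (cpoly_ring n). push \<phi> f = 0}"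
      "f \<otimes>\<^bsub>cpoly_ring n\<^esub> g \<in> {f \<in> carrier (cpoly_ring n). push \<phi> f = 0}"
      using f by (auto simp: cpoly_ring_def push_mult[OF \<phi>])
  qed
qed

text \<open>If \<open>u\<close> were alone in its level set of \<open>\<phi>\<close>, its coefficient would survive in \<open>push \<phi> f\<close>.\<close>

lemma push_zero_partner:
  assumes "push \<phi> f = 0" "u \<in> Poly_Mapping.keys f"
  shows "\<exists>v\<in>Poly_Mapping.keys f. v \<noteq> u \<and> \<phi> v = \<phi> u"
proof (rule ccontr)
  assume "\<not> ?thesis"
  then have "\<phi> v \<noteq> \<phi> u" if "v \<in> Poly_Mapping.keys f" "v \<noteq> u" for v using that by blast
  then have "Poly_Mapping.lookup (push \<phi> f) (\<phi> u)
      = (\<Sum>v\<in>Poly_Mapping.keys f. if v = u then Poly_Mapping.lookup f u else 0)"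
    unfolding push_def lookup_sum by (intro sum.cong) (auto simp: lookup_single when_def)
  then show False using assms by (simp add: in_keys_iff)
qed


section \<open>The invariants of the Sibirsky ideal\<close>

lemma lookup_rev_vec:
  "Poly_Mapping.lookup (rev_vec n u) i = (if i \<in> {1..n} then Poly_Mapping.lookup u (n + 1 - i) else 0)"
  by transfer simp

lemma rev_vec_zero [simp]: "rev_vec n 0 = 0"
  by (rule poly_mapping_eqI) (simp add: lookup_rev_vec)

lemma rev_vec_add: "rev_vec n (u + v) = rev_vec n u + rev_vec n v"
  by (rule poly_mapping_eqI) (simp add: lookup_rev_vec lookup_add)

lemma rev_vec_expvecs: "rev_vec n u \<in> expvecs n"
  by (auto simp: expvecs_def in_keys_iff lookup_rev_vec split: if_splits)

lemma rev_vec_rev_vec: "u \<in> expvecs n \<Longrightarrow> rev_vec n (rev_vec n u) = u"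
  by (rule poly_mapping_eqI) (auto simp: lookup_rev_vec expvecs_def in_keys_iff)

text \<open>The linear form with coefficient row \<open>(p\<^sub>1 - q\<^sub>1, ..., p\<^sub>l - q\<^sub>l, q\<^sub>l - p\<^sub>l, ..., q\<^sub>1 - p\<^sub>1)\<close>.\<close>

definition weight :: "nat \<Rightarrow> (nat \<Rightarrow> int) \<Rightarrow> (nat \<Rightarrow> nat) \<Rightarrow> expvec \<Rightarrow> int"
  where "weight l p q u = (\<Sum>j\<in>{1..l}. (p j - int (q j)) *
    (int (Poly_Mapping.lookup u j) - int (Poly_Mapping.lookup u (2 * l - j + 1))))"

lemma weight_add: "weight l p q (u + v) = weight l p q u + weight l p q v"
  by (simp add: weight_def lookup_add algebra_simps sum.distrib sum_subtractf)

lemma weight_rev_vec: "weight l p q (rev_vec (2 * l) u) = - weight l p q u"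
proof -
  have "Poly_Mapping.lookup (rev_vec (2 * l) u) j = Poly_Mapping.lookup u (2 * l - j + 1)"
    "Poly_Mapping.lookup (rev_vec (2 * l) u) (2 * l - j + 1) = Poly_Mapping.lookup u j"
    if "j \<in> {1..l}" for j
    using that by (auto simp: lookup_rev_vec Suc_diff_le)
  then show ?thesis
    unfolding weight_def sum_negf[symmetric] by (intro sum.cong) (auto simp: algebra_simps)
qed

text \<open>The number \<open>K\<close> with \<open>L(\<nu>) = (K, K)\<close> is automatically nonnegative, because twice \<open>K\<close> is the sum
  of the nonnegative terms \<open>(p\<^sub>j + q\<^sub>j) (\<nu>\<^sub>j + \<nu>\<^bsub>2l+1-j\<^esub>)\<close>.\<close>

lemma sib_monoid_iff_weight:
  assumes pq: "\<forall>j\<in>{1..l}. p j + int (q j) \<ge> 0"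
  shows "\<nu> \<in> sib_monoid l p q \<longleftrightarrow> \<nu> \<in> expvecs (2 * l) \<and> weight l p q \<nu> = 0"
proof -
  have diff: "fst (L l p q \<nu>) - snd (L l p q \<nu>) = weight l p q \<nu>"
    unfolding L_def weight_def fst_conv snd_conv sum_subtractf[symmetric]
    by (intro sum.cong) (auto simp: algebra_simps)
  have "fst (L l p q \<nu>) + snd (L l p q \<nu>) = (\<Sum>j\<in>{1..l}. (p j + int (q j)) *
      (int (Poly_Mapping.lookup \<nu> j) + int (Poly_Mapping.lookup \<nu> (2 * l - j + 1))))"
    unfolding L_def fst_conv snd_conv sum.distrib[symmetric]
    by (intro sum.cong) (auto simp: algebra_simps)
  also have "\<dots> \<ge> 0" using pq by (intro sum_nonneg mult_nonneg_nonneg) auto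
  finally have nonneg: "fst (L l p q \<nu>) + snd (L l p q \<nu>) \<ge> 0" .
  have "(\<exists>K::nat. L l p q \<nu> = (int K, int K)) \<longleftrightarrow> weight l p q \<nu> = 0"
  proof
    assume "\<exists>K::nat. L l p q \<nu> = (int K, int K)"
    then show "weight l p q \<nu> = 0" using diff by auto
  next
    assume "weight l p q \<nu> = 0"
    then have "L l p q \<nu> = (int (nat (fst (L l p q \<nu>))), int (nat (fst (L l p q \<nu>))))"
      using diff nonneg by (simp add: prod_eq_iff)
    then show "\<exists>K::nat. L l p q \<nu> = (int K, int K)" by blast
  qed
  then show ?thesis by (auto simp: sib_monoid_def)
qed

definition sib_invariant :: "nat \<Rightarrow> (nat \<Rightarrow> int) \<Rightarrow> (nat \<Rightarrow> nat) \<Rightarrow> expvec \<Rightarrow> expvec \<times> int"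
  where "sib_invariant l p q u = (u + rev_vec (2 * l) u, weight l p q u)"

lemma sib_invariant_add:
  "sib_invariant l p q (u + v) = sib_invariant l p q u + sib_invariant l p q v"
  by (simp add: sib_invariant_def rev_vec_add weight_add algebra_simps)

text \<open>Equality of \<open>u + rev u\<close> and \<open>v + rev v\<close> says that the difference of \<open>u\<close> and \<open>v\<close> in the integers
  changes sign under reversal, so that reversal exchanges its positive part \<open>u - v\<close> and its negative
  part \<open>v - u\<close>. The two parts then have opposite weights, while equality of the weights of \<open>u\<close> and \<open>v\<close>
  makes them equal, hence zero.\<close>

lemma sib_invariant_eqD:
  assumes u: "u \<in> expvecs (2 * l)" and v: "v \<in> expvecs (2 * l)"
    and eq: "sib_invariant l p q u = sib_invariant l p q v"
  shows "rev_vec (2 * l) (u - v) = v - u" and "weight l p q (u - v) = 0"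
proof -
  show rev: "rev_vec (2 * l) (u - v) = v - u"
  proof (rule poly_mapping_eqI)
    fix i
    have sum: "Poly_Mapping.lookup (u + rev_vec (2 * l) u) i = Poly_Mapping.lookup (v + rev_vec (2 * l) v) i"
      using eq by (simp add: sib_invariant_def)
    show "Poly_Mapping.lookup (rev_vec (2 * l) (u - v)) i = Poly_Mapping.lookup (v - u) i"
    proof (cases "i \<in> {1..2 * l}")
      case True
      then show ?thesis using sum by (simp add: lookup_rev_vec lookup_add lookup_minus)
    next
      case False
      then have "Poly_Mapping.lookup u i = 0" "Poly_Mapping.lookup v i = 0"
        using u v by (auto simp: expvecs_def in_keys_iff)
      then show ?thesis using False by (auto simp: lookup_rev_vec lookup_minus)
    qed
  qed
  have "u + (v - u) = v + (u - v)"
    by (rule poly_mapping_eqI) (simp add: lookup_add lookup_minus)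
  then have "weight l p q u + weight l p q (v - u) = weight l p q v + weight l p q (u - v)"
    by (metis weight_add)
  moreover have "weight l p q (v - u) = - weight l p q (u - v)"
    using weight_rev_vec[of l p q "u - v"] rev by simp
  ultimately show "weight l p q (u - v) = 0" using eq by (simp add: sib_invariant_def)
qed

lemma bracket_diff_carrier:
  "u \<in> expvecs n \<Longrightarrow> v \<in> expvecs n \<Longrightarrow> bracket u - bracket v \<in> carrier (cpoly_ring n)"
  by (cases "u = v") (auto simp: cpoly_ring_def keys_bracket_diff)

lemma sibirsky_ideal_push_zero:
  assumes pq: "\<forall>j\<in>{1..l}. p j + int (q j) \<ge> 0"
  shows "sibirsky_ideal l p q
    \<subseteq> {f \<in> carrier (cpoly_ring (2 * l)). push (sib_invariant l p q) f = 0}"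
proof -
  interpret R: cring "cpoly_ring (2 * l)" by (rule cring_cpoly_ring)
  show ?thesis
    unfolding sibirsky_ideal_def
  proof (rule R.genideal_minimal[OF ideal_push_kernel], rule sib_invariant_add, safe)
    fix \<nu> assume \<nu>: "\<nu> \<in> sib_monoid l p q"
    then have \<nu>': "\<nu> \<in> expvecs (2 * l)" "weight l p q \<nu> = 0"
      using sib_monoid_iff_weight[OF pq] by auto
    show "bracket \<nu> - bracket (rev_vec (2 * l) \<nu>) \<in> carrier (cpoly_ring (2 * l))"
      using \<nu>'(1) rev_vec_expvecs by (rule bracket_diff_carrier)
    have "sib_invariant l p q (rev_vec (2 * l) \<nu>) = sib_invariant l p q \<nu>"
      using \<nu>' by (simp add: sib_invariant_def rev_vec_rev_vec weight_rev_vec add.commute)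
    then show "push (sib_invariant l p q) (bracket \<nu> - bracket (rev_vec (2 * l) \<nu>)) = 0"
      by (simp add: push_diff bracket_def push_single)
  qed
qed

text \<open>The leading exponent \<open>u\<close> has a smaller partner \<open>v\<close> in its level set; \<open>w\<close> is the componentwise
  minimum of \<open>u\<close> and \<open>v\<close>, and \<open>\<nu>\<close> is the truncated difference \<open>u - v\<close>, whose reversal is \<open>v - u\<close>.\<close>

lemma sibirsky_lead_exp_partner:
  assumes pq: "\<forall>j\<in>{1..l}. p j + int (q j) \<ge> 0" and r: "monomial_order (2 * l) r"
    and f: "f \<in> sibirsky_ideal l p q" "f \<noteq> 0"
  shows "\<exists>w\<in>expvecs (2 * l). \<exists>\<nu>\<in>sib_monoid l p q.
    lead_exp r f = w + \<nu> \<and> (\<nu>, rev_vec (2 * l) \<nu>) \<notin> r"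
proof -
  define u where "u = lead_exp r f"
  have keys: "Poly_Mapping.keys f \<subseteq> expvecs (2 * l)" and push: "push (sib_invariant l p q) f = 0"
    using sibirsky_ideal_push_zero[OF pq] f(1) by (auto simp: cpoly_ring_def)
  have u: "u \<in> Poly_Mapping.keys f" "\<And>v. v \<in> Poly_Mapping.keys f \<Longrightarrow> (v, u) \<in> r"
    unfolding u_def by (rule lead_exp_greatest[OF r keys f(2)], assumption?)+
  obtain v where v: "v \<in> Poly_Mapping.keys f" "v \<noteq> u"
      "sib_invariant l p q v = sib_invariant l p q u"
    using push_zero_partner[OF push u(1)] by blast
  have uv: "u \<in> expvecs (2 * l)" "v \<in> expvecs (2 * l)" using u(1) v(1) keys by auto
  \<comment> \<open>With truncated subtraction, this is the componentwise minimum.\<close>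
  define w where "w = u - (u - v)"
  have w: "w \<in> expvecs (2 * l)" unfolding w_def by (rule diff_expvecs[OF uv(1)])
  have rev: "rev_vec (2 * l) (u - v) = v - u" and "weight l p q (u - v) = 0"
    using sib_invariant_eqD[OF uv v(3)[symmetric]] by auto
  then have "u - v \<in> sib_monoid l p q"
    using sib_monoid_iff_weight[OF pq] diff_expvecs[OF uv(1)] by blast
  moreover have decomp: "u = (u - v) + w" "v = (v - u) + w"
    by (rule poly_mapping_eqI, simp add: w_def lookup_add lookup_minus)+
  moreover have "(u - v, rev_vec (2 * l) (u - v)) \<notin> r"
  proof
    assume "(u - v, rev_vec (2 * l) (u - v)) \<in> r"
    then have "(u, v) \<in> r" using monomial_order_add[OF r _ w] rev decomp by metis
    then show False using monomial_order_antisym[OF r] u(2)[OF v(1)] v(2) by blast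
  qed
  ultimately show ?thesis using w unfolding u_def[symmetric] by (metis add.commute)
qed


section \<open>The Groebner basis\<close>

theorem theorem3p2:
  fixes l :: nat and p :: "nat \<Rightarrow> int" and q :: "nat \<Rightarrow> nat" and r :: "expvec rel"
  assumes "inj_on (\<lambda>j. (p j, q j)) {1..l}"
    and "\<forall>j\<in>{1..l}. p j \<ge> -1 \<and> p j + int (q j) \<ge> 1"
    and "monomial_order (2 * l) r"
  shows "groebner_basis (2 * l) r
    {bracket \<nu> - bracket (rev_vec (2 * l) \<nu>) | \<nu>.
      \<nu> \<in> hilbert_basis (sib_monoid l p q) \<and> \<nu> \<noteq> rev_vec (2 * l) \<nu>}
    (sibirsky_ideal l p q)"
proof -
  define M where "M = sib_monoid l p q"
  define H where "H = hilbert_basis M"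
  define I where "I = sibirsky_ideal l p q"
  define G where "G = {bracket \<nu> - bracket (rev_vec (2 * l) \<nu>) | \<nu>.
      \<nu> \<in> hilbert_basis (sib_monoid l p q) \<and> \<nu> \<noteq> rev_vec (2 * l) \<nu>}"
  interpret R: cring "cpoly_ring (2 * l)" by (rule cring_cpoly_ring)
  note r = assms(3)
  have pq: "\<forall>j\<in>{1..l}. p j + int (q j) \<ge> 0" using assms(2) by force
  have M: "add_submonoid M" "M \<subseteq> expvecs (2 * l)"
    unfolding M_def by (rule add_submonoid_sib_monoid) (auto simp: sib_monoid_def)
  have hull: "add_submonoid hull H = M"
    using hilbert_basis_minimal[OF M(1)] by (simp add: minimal_generating_set_def H_def)
  then have HM: "H \<subseteq> M" using hull_subset by metis
  have diff: "d \<in> M" if "u \<in> M" "u + d \<in> M" for u d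
  proof -
    have "Poly_Mapping.keys d \<subseteq> Poly_Mapping.keys (u + d)"
      by (auto simp: in_keys_iff lookup_add)
    then show ?thesis
      using that sib_monoid_iff_weight[OF pq] by (auto simp: M_def weight_add expvecs_def)
  qed
  have "finite H" unfolding H_def by (rule finite_hilbert_basis[OF M diff])
  then have fin: "finite G" unfolding G_def H_def M_def by simp
  have gens: "{bracket \<nu> - bracket (rev_vec (2 * l) \<nu>) | \<nu>. \<nu> \<in> M} \<subseteq> carrier (cpoly_ring (2 * l))"
    using M(2) bracket_diff_carrier rev_vec_expvecs by blast
  have "G \<subseteq> {bracket \<nu> - bracket (rev_vec (2 * l) \<nu>) | \<nu>. \<nu> \<in> M}"
    using HM by (auto simp: G_def H_def M_def)
  also have "\<dots> \<subseteq> I"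
    unfolding I_def sibirsky_ideal_def M_def[symmetric] by (rule R.genideal_self[OF gens])
  finally have "G \<subseteq> I" .
  moreover have "0 \<notin> G"
  proof
    assume "0 \<in> G"
    then obtain \<nu> where "\<nu> \<noteq> rev_vec (2 * l) \<nu>" "bracket \<nu> - bracket (rev_vec (2 * l) \<nu>) = 0"
      unfolding G_def by force
    then show False using keys_bracket_diff by fastforce
  qed
  ultimately have GI: "G \<subseteq> I - {0}" by blast
  have LT_carrier: "lead_term r f \<in> carrier (cpoly_ring (2 * l))" if f: "f \<in> I - {0}" for f
  proof -
    have "Poly_Mapping.keys f \<subseteq> expvecs (2 * l)"
      using f sibirsky_ideal_push_zero[OF pq] by (auto simp: I_def cpoly_ring_def)
    then have "lead_exp r f \<in> expvecs (2 * l)" using lead_exp_greatest(1)[OF r] f by blast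
    then show ?thesis by (simp add: lead_term_def cpoly_ring_def)
  qed
  define J where "J = Idl\<^bsub>cpoly_ring (2 * l)\<^esub> (lead_term r ` G)"
  have LTG: "lead_term r ` G \<subseteq> carrier (cpoly_ring (2 * l))" using LT_carrier GI by blast
  interpret J: ideal J "cpoly_ring (2 * l)"
    unfolding J_def by (rule R.genideal_ideal[OF LTG])
  have "lead_term r f \<in> J" if f: "f \<in> I - {0}" for f
  proof -
    \<comment> \<open>The leading exponent is \<open>w + \<nu> = w + d + h\<close>, with \<open>h\<close> the leading exponent of an element of \<open>G\<close>.\<close>
    obtain w \<nu> where \<nu>: "w \<in> expvecs (2 * l)" "\<nu> \<in> M" "lead_exp r f = w + \<nu>"
        "(\<nu>, rev_vec (2 * l) \<nu>) \<notin> r"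
      using sibirsky_lead_exp_partner[OF pq r, of f] f unfolding I_def M_def by blast
    obtain h d where h: "h \<in> H" "d \<in> expvecs (2 * l)" "\<nu> = h + d"
        "(rev_vec (2 * l) h, h) \<in> r" "h \<noteq> rev_vec (2 * l) h"
      using hull_descending_generator[OF r, of H "rev_vec (2 * l)" \<nu>] HM M(2) \<nu> hull
      by (auto simp: rev_vec_add rev_vec_expvecs)
    have "lead_term r (bracket h - bracket (rev_vec (2 * l) h)) = bracket h"
      using h HM M(2) by (intro lead_term_bracket_diff[OF r]) auto
    moreover have "bracket h - bracket (rev_vec (2 * l) h) \<in> G"
      using h by (auto simp: G_def H_def M_def)
    ultimately have "bracket h \<in> J"
      unfolding J_def using R.genideal_self[OF LTG] by (metis image_eqI subsetD)
    define c where "c = Poly_Mapping.single (w + d) (Poly_Mapping.lookup f (lead_exp r f))"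
    have "c \<in> carrier (cpoly_ring (2 * l))"
      using add_expvecs[OF \<nu>(1) h(2)] by (simp add: c_def cpoly_ring_def)
    then have "c \<otimes>\<^bsub>cpoly_ring (2 * l)\<^esub> bracket h \<in> J"
      using \<open>bracket h \<in> J\<close> by (rule J.I_l_closed[rotated])
    moreover have "c \<otimes>\<^bsub>cpoly_ring (2 * l)\<^esub> bracket h = lead_term r f"
      using \<nu>(3) h(3)
      by (simp add: c_def cpoly_ring_def bracket_def mult_single lead_term_def algebra_simps)
    ultimately show ?thesis by simp
  qed
  then have "Idl\<^bsub>cpoly_ring (2 * l)\<^esub> (lead_term r ` (I - {0})) \<subseteq> J"
    by (intro R.genideal_minimal[OF J.is_ideal]) auto
  moreover have "J \<subseteq> Idl\<^bsub>cpoly_ring (2 * l)\<^esub> (lead_term r ` (I - {0}))"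
    unfolding J_def by (rule R.subset_Idl_subset) (use GI LT_carrier in auto)
  ultimately have "groebner_basis (2 * l) r G I"
    using fin GI by (auto simp: groebner_basis_def J_def)
  then show ?thesis unfolding G_def I_def .
qed

end
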